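(* Let $\kappa,\bar\kappa\colon[a,b]\to\mathbb{R}$ be continuous and let $n$ and $\ell$ be integers with $0\le\ell<n$. Let $y,\bar y\colon[a,b]\to\mathbb{R}$ be $C^n$ functions that satisfy the $n$-th order differential equations $$y^{(n)}+\kappa\, y^{(\ell)}=f\quad\text{and}\quad \bar y^{(n)}+\bar\kappa\,\bar y^{(\ell)}=f$$ for some continuous function $f$ on $[a,b]$, and have the same initial conditions at $a$: $y^{(j)}(a)=\bar y^{(j)}(a)$ for $j=0,1,\ldots,n-1$. Assume (a) the Lagrange kernel $\bar K$ of the differential operator $\bar y\mapsto\bar y^{(n)}+\bar\kappa\,\bar y^{(\ell)}$ is forward positive on $[a,b]$, and (b) $y^{(\ell)}>0$ almost everywhere on $[a,b]$. Then $$\kappa\le\bar\kappa\text{ on }[a,b]\quad\text{implies}\quad y\ge\bar y\text{ on }[a,b],$$ $$\kappa\ge\bar\kappa\text{ on }[a,b]\quad\text{implies}\quad y\le\bar y\text{ on }[a,b].$$ Moreover, in either of these cases, if $y(b)=\bar y(b)$, then $\kappa(s)=\bar\kappa(s)$ and $y(s)=\bar y(s)$ for all $s\in[a,b]$.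
   Context: For a linear differential operator $\mathcal{D}y=y^{(n)}+\sum_{j=0}^{n-1}a_j(s)y^{(j)}$ with continuous coefficients on an interval $I$, the Lagrange kernel of $\mathcal{D}$ is the function $K\colon I\times I\to\mathbb{R}$ such that for each fixed $r\in I$ the function $s\mapsto K(s;r)$ solves $$\frac{\partial^nK}{\partial s^n}(s;r)+\sum_{j=0}^{n-1}a_j(s)\frac{\partial^jK}{\partial s^j}(s;r)=0,$$ with $\frac{\partial^jK}{\partial s^j}(r;r)=0$ for $0\le j\le n-2$ and $\frac{\partial^{n-1}K}{\partial s^{n-1}}(r;r)=1$. The kernel $K$ is forward positive on $I$ if for all $r,s\in I$, $s>r$ implies $K(s;r)\ge0$. *)

theory Defs
  imports "HOL-Analysis.Analysis"
begin

(* Iterated derivative relative to a set S, so that on a closed interval the derivatives at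
   the endpoints are one-sided.  It is meaningful only where the derivatives exist and are
   unique, e.g. for a C_n function on a non-degenerate interval. *)
primrec nderiv_on :: "real set \<Rightarrow> nat \<Rightarrow> (real \<Rightarrow> real) \<Rightarrow> real \<Rightarrow> real" where
  "nderiv_on S 0 f = f"
| "nderiv_on S (Suc k) f = (\<lambda>x. vector_derivative (nderiv_on S k f) (at x within S))"

(* Continuity of the lower derivatives is automatic from differentiability. *)
definition Cn_on :: "nat \<Rightarrow> (real \<Rightarrow> real) \<Rightarrow> real set \<Rightarrow> bool" where
  "Cn_on n f S \<longleftrightarrow>
     (\<forall>k<n. nderiv_on S k f differentiable_on S) \<and> continuous_on S (nderiv_on S n f)"

(* D y = y^(n) + (\<Sum>j<n. c_j y^(j)), with derivatives taken on I *)
definition lin_diff_op ::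
  "real set \<Rightarrow> nat \<Rightarrow> (nat \<Rightarrow> real \<Rightarrow> real) \<Rightarrow> (real \<Rightarrow> real) \<Rightarrow> real \<Rightarrow> real" where
  "lin_diff_op I n c y s = nderiv_on I n y s + (\<Sum>j<n. c j s * nderiv_on I j y s)"

(* K s r stands for K(s;r); all derivatives are in the first argument s.  The kernel is
   determined only on I \<times> I, hence a predicate rather than a function.  Intended for
   n \<ge> 1, where j < n - 1 means 0 \<le> j \<le> n - 2. *)
definition is_Lagrange_kernel ::
  "real set \<Rightarrow> nat \<Rightarrow> (nat \<Rightarrow> real \<Rightarrow> real) \<Rightarrow> (real \<Rightarrow> real \<Rightarrow> real) \<Rightarrow> bool" where
  "is_Lagrange_kernel I n c K \<longleftrightarrow>
     (\<forall>r\<in>I. Cn_on n (\<lambda>s. K s r) I \<and>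
            (\<forall>s\<in>I. lin_diff_op I n c (\<lambda>s. K s r) s = 0) \<and>
            (\<forall>j<n - 1. nderiv_on I j (\<lambda>s. K s r) r = 0) \<and>
            nderiv_on I (n - 1) (\<lambda>s. K s r) r = 1)"

definition forward_positive :: "real set \<Rightarrow> (real \<Rightarrow> real \<Rightarrow> real) \<Rightarrow> bool" where
  "forward_positive I K \<longleftrightarrow> (\<forall>r\<in>I. \<forall>s\<in>I. s > r \<longrightarrow> K s r \<ge> 0)"

end

theory Submission
  imports Defs
begin

text \<open>
  Let \<open>u = y - y'\<close>. Subtracting the two equations gives
  \<open>u\<^sup>(\<^sup>n\<^sup>) + \<kappa>' u\<^sup>(\<^sup>l\<^sup>) = h\<close> with
  \<open>h = (\<kappa>' - \<kappa>) y\<^sup>(\<^sup>l\<^sup>)\<close> and zero data at \<open>a\<close>, so Duhamel's formula (lemma \<open>duhamel\<close>) expresses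
  \<open>u s\<close> as the integral of \<open>K' s r * h r\<close> over \<open>a \<le> r \<le> s\<close>. By continuity \<open>y\<^sup>(\<^sup>l\<^sup>) \<ge> 0\<close> everywhere, so
  \<open>h\<close> has the sign of \<open>\<kappa>' - \<kappa>\<close>, and forward positivity transfers that sign to \<open>u\<close>.

  If moreover \<open>u b = 0\<close>, then the continuous function \<open>K' b r * h r\<close> of constant sign has integral
  \<open>0\<close> and vanishes for every \<open>r\<close>. If \<open>h\<close> were nonzero somewhere, it would be nonzero on an
  interval, and \<open>K' b\<close> would vanish there. Lemma \<open>kernel_not_vanishing_on_interval\<close> excludes this
  by a controllability argument: a homogeneous solution \<open>v\<close> with \<open>v b \<noteq> 0\<close>, multiplied by a
  \<open>C\<^sup>n\<close> step that rises from \<open>0\<close> to \<open>1\<close> inside the interval, has zero data at \<open>a\<close> and a source supported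
  in the interval, so Duhamel's formula would give \<open>v b = 0\<close>. Hence \<open>h = 0\<close>; then \<open>u = 0\<close>, and
  \<open>\<kappa> = \<kappa>'\<close> wherever \<open>y\<^sup>(\<^sup>l\<^sup>) > 0\<close>, which is a dense set, hence everywhere by continuity.

  The definition of the kernel says nothing about its dependence on \<open>r\<close>, while Duhamel's formula
  integrates in \<open>r\<close>. The missing regularity comes from a Gronwall estimate: a homogeneous solution is
  bounded on all of \<open>[a, b]\<close> by a constant times its data at any one point
  (lemma \<open>homogeneous_stability\<close>). Since \<open>K(\<cdot>; r)\<close> and \<open>K(\<cdot>; r')\<close> have data at \<open>r'\<close> that differ by
  \<open>O(|r - r'|)\<close>, the kernel and its derivatives of order below \<open>n\<close> are Lipschitz in both
  variables.
\<close>

section \<open>Jets of functions of one real variable\<close>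

text \<open>
  A jet records a function \<open>v 0\<close> together with its successive derivatives \<open>v 1, \<dots>, v n\<close>. Taking the
  derivatives as data keeps sums and products of jets free of iterated derivative
  operators.
\<close>

definition jet_on :: "real set \<Rightarrow> nat \<Rightarrow> (nat \<Rightarrow> real \<Rightarrow> real) \<Rightarrow> bool" where
  "jet_on S n v \<longleftrightarrow>
     (\<forall>j<n. \<forall>s\<in>S. (v j has_real_derivative v (Suc j) s) (at s within S))"

lemma jet_onD:
  "jet_on S n v \<Longrightarrow> j < n \<Longrightarrow> s \<in> S \<Longrightarrow> (v j has_real_derivative v (Suc j) s) (at s within S)"
  by (simp add: jet_on_def)

lemma jet_on_continuous: "jet_on S n v \<Longrightarrow> j < n \<Longrightarrow> continuous_on S (v j)"
  using DERIV_continuous_on jet_onD by blast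

lemma jet_on_subset: "jet_on S n v \<Longrightarrow> T \<subseteq> S \<Longrightarrow> jet_on T n v"
  by (meson DERIV_subset jet_on_def subsetD)

lemma jet_on_diff: "jet_on S n v \<Longrightarrow> jet_on S n w \<Longrightarrow> jet_on S n (\<lambda>j s. v j s - w j s)"
  by (auto simp: jet_on_def intro!: derivative_intros)

lemma jet_on_uminus: "jet_on S n v \<Longrightarrow> jet_on S n (\<lambda>j s. - v j s)"
  by (auto simp: jet_on_def intro!: derivative_intros)

lemma Cn_on_imp_jet_on:
  assumes "a < b" "Cn_on n f {a..b}"
  shows "jet_on {a..b} n (\<lambda>j. nderiv_on {a..b} j f)"
  unfolding jet_on_def
proof (intro allI impI ballI)
  fix j s assume j: "j < n" and s: "s \<in> {a..b}"
  have "nderiv_on {a..b} j f differentiable (at s within {a..b})"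
    using assms(2) j s by (simp add: Cn_on_def differentiable_on_def)
  then obtain D where D: "(nderiv_on {a..b} j f has_vector_derivative D) (at s within {a..b})"
    using vector_derivative_works by blast
  then have "vector_derivative (nderiv_on {a..b} j f) (at s within {a..b}) = D"
    using vector_derivative_within_closed_interval assms(1) s by blast
  with D show "(nderiv_on {a..b} j f has_real_derivative nderiv_on {a..b} (Suc j) f s)
      (at s within {a..b})"
    by (simp add: has_real_derivative_iff_has_vector_derivative)
qed

text \<open>Leibniz's rule; the inductive step is Pascal's identity.\<close>

lemma jet_on_mult:
  assumes v: "jet_on S n v" and w: "jet_on S n w"
  shows "jet_on S n (\<lambda>j s. \<Sum>i\<le>j. real (j choose i) * v i s * w (j - i) s)"
  unfolding jet_on_def
proof (intro allI impI ballI)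
  fix j s assume j: "j < n" and s: "s \<in> S"
  have split: "(\<Sum>i\<le>Suc j. real (Suc j choose i) * v i s * w (Suc j - i) s) =
      (\<Sum>i\<le>j. real (j choose i) * v (Suc i) s * w (j - i) s) +
      (\<Sum>i\<le>j. real (j choose i) * v i s * w (Suc (j - i)) s)"
  proof -
    have "(\<Sum>i\<le>Suc j. real (Suc j choose i) * v i s * w (Suc j - i) s) =
        v 0 s * w (Suc j) s +
        (\<Sum>i\<le>j. real (Suc j choose Suc i) * v (Suc i) s * w (j - i) s)"
      by (subst sum.atMost_Suc_shift) simp
    also have "(\<Sum>i\<le>j. real (Suc j choose Suc i) * v (Suc i) s * w (j - i) s) =
        (\<Sum>i\<le>j. real (j choose i) * v (Suc i) s * w (j - i) s) +
        (\<Sum>i\<le>j. real (j choose Suc i) * v (Suc i) s * w (j - i) s)"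
      by (simp add: sum.distrib algebra_simps)
    also have "v 0 s * w (Suc j) s + \<dots> =
        (\<Sum>i\<le>j. real (j choose i) * v (Suc i) s * w (j - i) s) +
        (\<Sum>i\<le>Suc j. real (j choose i) * v i s * w (Suc j - i) s)"
      by (simp only: sum.atMost_Suc_shift) simp
    also have "(\<Sum>i\<le>Suc j. real (j choose i) * v i s * w (Suc j - i) s) =
        (\<Sum>i\<le>j. real (j choose i) * v i s * w (Suc (j - i)) s)"
      by (simp add: Suc_diff_le)
    finally show ?thesis .
  qed
  show "((\<lambda>s. \<Sum>i\<le>j. real (j choose i) * v i s * w (j - i) s) has_real_derivative
      (\<Sum>i\<le>Suc j. real (Suc j choose i) * v i s * w (Suc j - i) s)) (at s within S)"
    unfolding split sum.distrib[symmetric]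
    using j s by (auto intro!: derivative_eq_intros sum.cong jet_onD[OF v] jet_onD[OF w]
        simp: algebra_simps)
qed

text \<open>
  Such a step is obtained by the recursion for B-splines: if \<open>\<phi>\<close> is a \<open>C\<^sup>n\<close> step on \<open>[c, m]\<close> with
  antiderivative \<open>\<Phi>\<close>, then the moving average \<open>(\<Phi> s - \<Phi> (s - \<tau>)) / \<tau>\<close> is a \<open>C\<^sup>n\<^sup>+\<^sup>1\<close> step on
  \<open>[c, m + \<tau>]\<close>, because \<open>\<Phi>\<close> is constant to the left of \<open>c\<close> and has slope \<open>1\<close> to the right of \<open>m\<close>.
\<close>

lemma smooth_step_jet:
  assumes "c < d"
  shows "\<exists>\<theta>. jet_on UNIV n \<theta> \<and> continuous_on UNIV (\<theta> n) \<and>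
     (\<forall>s\<le>c. \<theta> 0 s = 0) \<and> (\<forall>s\<ge>d. \<theta> 0 s = 1) \<and>
     (\<forall>j s. 0 < j \<longrightarrow> j \<le> n \<longrightarrow> s \<le> c \<or> d \<le> s \<longrightarrow> \<theta> j s = 0)"
  using assms
proof (induction n arbitrary: d)
  case 0
  define \<theta> where "\<theta> = (\<lambda>j::nat. \<lambda>s. max 0 (min 1 ((s - c) / (d - c))))"
  have "continuous_on UNIV (\<theta> 0)"
    using 0 unfolding \<theta>_def by (intro continuous_intros) auto
  moreover have "\<forall>s\<le>c. \<theta> 0 s = 0" "\<forall>s\<ge>d. \<theta> 0 s = 1"
    using 0 by (auto simp: \<theta>_def divide_simps max_def min_def)
  ultimately show ?case
    by (intro exI[of _ \<theta>]) (auto simp: jet_on_def)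
next
  case (Suc n)
  define m where "m = (c + d) / 2"
  define \<tau> where "\<tau> = d - m"
  have m: "c < m" "\<tau> > 0" "m + \<tau> = d" using Suc.prems by (auto simp: m_def \<tau>_def field_simps)
  obtain \<phi> where \<phi>': "jet_on UNIV n \<phi>" "continuous_on UNIV (\<phi> n)"
     "\<forall>s\<le>c. \<phi> 0 s = 0" "\<forall>s\<ge>m. \<phi> 0 s = 1"
     "\<forall>j s. 0 < j \<longrightarrow> j \<le> n \<longrightarrow> s \<le> c \<or> m \<le> s \<longrightarrow> \<phi> j s = 0"
    using Suc.IH[OF m(1)] by blast
  note \<phi> = \<phi>'[rule_format]
  have cont0: "continuous_on UNIV (\<phi> 0)"
    by (metis \<phi>(1,2) gr0I jet_on_continuous)
  have "\<exists>F. \<forall>x::real. (-\<infinity>::ereal) < x \<longrightarrow> x < (\<infinity>::ereal) \<longrightarrow> (F has_vector_derivative \<phi> 0 x) (at x)"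
    by (rule einterval_antiderivative) (use cont0 in \<open>auto simp: continuous_on_eq_continuous_at\<close>)
  then obtain \<Phi> where \<Phi>: "\<And>x. (\<Phi> has_real_derivative \<phi> 0 x) (at x)"
    by (auto simp: has_real_derivative_iff_has_vector_derivative)
  have "\<exists>C. \<forall>s\<in>{..c}. \<Phi> s = C"
    by (rule has_field_derivative_zero_constant)
       (use \<Phi> \<phi>(3) in \<open>auto intro: has_field_derivative_at_within simp: convex_real_interval\<close>,
        metis has_field_derivative_at_within)
  then obtain C where C: "\<And>s. s \<le> c \<Longrightarrow> \<Phi> s = C" by auto
  have "\<exists>D. \<forall>s\<in>{m..}. \<Phi> s - s = D"
  proof (rule has_field_derivative_zero_constant)
    fix s assume "s \<in> {m..}"
    then show "((\<lambda>s. \<Phi> s - s) has_real_derivative 0) (at s within {m..})"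
      by (auto intro!: derivative_eq_intros has_field_derivative_at_within[OF \<Phi>] simp: \<phi>(4))
  qed (simp add: convex_real_interval)
  then obtain D where D: "\<And>s. m \<le> s \<Longrightarrow> \<Phi> s = s + D"
    by (metis atLeast_iff diff_add_cancel add.commute)
  define \<theta> where "\<theta> = (\<lambda>j s. case j of 0 \<Rightarrow> (\<Phi> s - \<Phi> (s - \<tau>)) / \<tau>
     | Suc i \<Rightarrow> (\<phi> i s - \<phi> i (s - \<tau>)) / \<tau>)"
  have der: "((\<lambda>s. (g s - g (s - \<tau>)) / \<tau>) has_real_derivative (g' s - g' (s - \<tau>)) / \<tau>) (at s)"
    if "\<And>x. (g has_real_derivative g' x) (at x)" for g g' s
    using m(2) by (auto intro!: derivative_eq_intros DERIV_chain'[where g = g] that)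
  have "jet_on UNIV (Suc n) \<theta>"
    unfolding jet_on_def
  proof (intro allI impI ballI)
    fix j s assume "j < Suc n"
    then show "(\<theta> j has_real_derivative \<theta> (Suc j) s) (at s)"
      using der[of \<Phi> "\<phi> 0"] \<Phi> der[of "\<phi> (j-1)" "\<phi> j"] jet_onD[OF \<phi>(1), of "j - 1"]
      by (cases j) (auto simp: \<theta>_def)
  qed
  moreover have "continuous_on UNIV (\<theta> (Suc n))"
    using m(2) by (auto simp: \<theta>_def intro!: continuous_intros continuous_on_compose2[OF \<phi>(2)])
  moreover have "\<forall>s\<le>c. \<theta> 0 s = 0"
    using m by (auto simp: \<theta>_def C)
  moreover have "\<forall>s\<ge>d. \<theta> 0 s = 1"
    using m by (auto simp: \<theta>_def D)
  moreover have "\<theta> j s = 0" if js: "0 < j" "j \<le> Suc n" "s \<le> c \<or> d \<le> s" for j s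
  proof -
    obtain i where i: "j = Suc i" "i \<le> n" using js by (cases j) auto
    show ?thesis
      using js(3) m \<phi>(3,4) \<phi>(5)[of i s] \<phi>(5)[of i "s - \<tau>"] i
      by (cases "i = 0") (auto simp: \<theta>_def)
  qed
  ultimately show ?case by blast
qed

section \<open>Lagrange kernels and Duhamel's formula\<close>

text \<open>
  The bound on \<open>E'\<close> makes \<open>exp (- L s) E s\<close> decreasing and \<open>exp (L s) E s\<close> increasing, which
  covers \<open>s\<close> on either side of \<open>r\<close>.
\<close>

lemma gronwall_two_sided:
  fixes E E' :: "real \<Rightarrow> real"
  assumes der: "\<And>s. s \<in> {a..b} \<Longrightarrow> (E has_real_derivative E' s) (at s within {a..b})"
    and bound: "\<And>s. s \<in> {a..b} \<Longrightarrow> \<bar>E' s\<bar> \<le> L * E s"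
    and r: "r \<in> {a..b}" and s: "s \<in> {a..b}"
  shows "E s \<le> exp (L * \<bar>s - r\<bar>) * E r"
proof -
  have inner: "(E has_real_derivative E' x) (at x)" if "a < x" "x < b" for x
    using der[of x] that at_within_Icc_at[of a x b] by auto
  have cont: "continuous_on {a..b} E"
    using der DERIV_continuous_on by blast
  show ?thesis
  proof (cases "r \<le> s")
    case True
    have "exp (- L * s) * E s \<le> exp (- L * r) * E r"
    proof (rule DERIV_nonpos_imp_decreasing_open[OF True])
      fix x assume x: "r < x" "x < s"
      have "((\<lambda>x. exp (- L * x) * E x) has_real_derivative exp (- L * x) * (E' x - L * E x)) (at x)"
        using x r s by (auto intro!: derivative_eq_intros inner simp: algebra_simps)
      moreover have "exp (- L * x) * (E' x - L * E x) \<le> 0"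
        using bound[of x] x r s by (intro mult_nonneg_nonpos) auto
      ultimately show "\<exists>y. ((\<lambda>x. exp (- L * x) * E x) has_real_derivative y) (at x) \<and> y \<le> 0"
        by blast
    next
      show "continuous_on {r..s} (\<lambda>x. exp (- L * x) * E x)"
        using r s by (auto intro!: continuous_intros continuous_on_subset[OF cont])
    qed
    then have "exp (L * s) * (exp (- L * s) * E s) \<le> exp (L * s) * (exp (- L * r) * E r)"
      by (intro mult_left_mono) auto
    moreover have "exp (L * s) * exp (- L * s) = 1"
      "exp (L * s) * exp (- L * r) = exp (L * \<bar>s - r\<bar>)"
      using True by (simp_all flip: exp_add add: right_diff_distrib)
    ultimately show ?thesis by (metis mult.assoc mult_1)
  next
    case False
    then have sr: "s \<le> r" by simp
    have "exp (L * s) * E s \<le> exp (L * r) * E r"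
    proof (rule DERIV_nonneg_imp_increasing_open[OF sr])
      fix x assume x: "s < x" "x < r"
      have "((\<lambda>x. exp (L * x) * E x) has_real_derivative exp (L * x) * (E' x + L * E x)) (at x)"
        using x r s by (auto intro!: derivative_eq_intros inner simp: algebra_simps)
      moreover have "exp (L * x) * (E' x + L * E x) \<ge> 0"
        using bound[of x] x r s by (intro mult_nonneg_nonneg) auto
      ultimately show "\<exists>y. ((\<lambda>x. exp (L * x) * E x) has_real_derivative y) (at x) \<and> y \<ge> 0"
        by blast
    next
      show "continuous_on {s..r} (\<lambda>x. exp (L * x) * E x)"
        using r s by (auto intro!: continuous_intros continuous_on_subset[OF cont])
    qed
    then have "exp (- L * s) * (exp (L * s) * E s) \<le> exp (- L * s) * (exp (L * r) * E r)"
      by (intro mult_left_mono) auto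
    moreover have "exp (- L * s) * exp (L * s) = 1"
      "exp (- L * s) * exp (L * r) = exp (L * \<bar>s - r\<bar>)"
      using sr by (simp_all flip: exp_add add: right_diff_distrib)
    ultimately show ?thesis by (metis mult.assoc mult_1)
  qed
qed

text \<open>
  Here \<open>k j s r\<close> stands for the \<open>j\<close>-th derivative of the kernel \<open>K(s; r)\<close> in \<open>s\<close>,
  for the operator with coefficients \<open>c\<close>.
\<close>

locale lagrange_jets =
  fixes a b :: real and n :: nat and c :: "nat \<Rightarrow> real \<Rightarrow> real"
    and k :: "nat \<Rightarrow> real \<Rightarrow> real \<Rightarrow> real"
  assumes ab: "a < b" and n_pos: "0 < n"
    and c_cont: "\<And>j. j < n \<Longrightarrow> continuous_on {a..b} (c j)"
    and k_jet: "\<And>r. r \<in> {a..b} \<Longrightarrow> jet_on {a..b} n (\<lambda>j s. k j s r)"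
    and k_hom: "\<And>r s. r \<in> {a..b} \<Longrightarrow> s \<in> {a..b} \<Longrightarrow> k n s r + (\<Sum>j<n. c j s * k j s r) = 0"
    and k_diag: "\<And>r j. r \<in> {a..b} \<Longrightarrow> j < n \<Longrightarrow> k j r r = (if j = n - 1 then 1 else 0)"
begin

definition lin_op :: "(nat \<Rightarrow> real \<Rightarrow> real) \<Rightarrow> real \<Rightarrow> real" where
  "lin_op v s = v n s + (\<Sum>j<n. c j s * v j s)"

lemma coeffs_bounded:
  obtains M where "M \<ge> 0" "\<And>j s. j < n \<Longrightarrow> s \<in> {a..b} \<Longrightarrow> \<bar>c j s\<bar> \<le> M"
proof -
  have "bounded (\<Union>j<n. c j ` {a..b})"
    by (auto intro!: compact_imp_bounded compact_continuous_image c_cont)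
  then obtain M where M: "\<And>x. x \<in> (\<Union>j<n. c j ` {a..b}) \<Longrightarrow> norm x \<le> M"
    by (auto simp: bounded_iff)
  show thesis
  proof (rule that[of "max 0 M"])
    fix j s assume "j < n" "s \<in> {a..b}"
    then show "\<bar>c j s\<bar> \<le> max 0 M" using M[of "c j s"] by fastforce
  qed simp
qed

text \<open>
  The energy \<open>E = \<Sum>j<n. (v j)\<^sup>2\<close> of a homogeneous solution satisfies \<open>\<bar>E'\<bar> \<le> L E\<close>: every summand of
  \<open>E'\<close> is a combination with bounded coefficients of products of two of the entries
  \<open>v 0, \<dots>, v (n - 1)\<close>, after the equation is used to eliminate \<open>v n\<close>. For zero data this is
  uniqueness for the initial value problem.
\<close>

lemma homogeneous_stability:
  obtains C where "C \<ge> 0"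
    "\<And>v r s j. jet_on {a..b} n v \<Longrightarrow> (\<And>t. t \<in> {a..b} \<Longrightarrow> lin_op v t = 0) \<Longrightarrow>
       r \<in> {a..b} \<Longrightarrow> s \<in> {a..b} \<Longrightarrow> j < n \<Longrightarrow> \<bar>v j s\<bar> \<le> C * (\<Sum>i<n. \<bar>v i r\<bar>)"
proof -
  obtain M where M: "M \<ge> 0" "\<And>j s. j < n \<Longrightarrow> s \<in> {a..b} \<Longrightarrow> \<bar>c j s\<bar> \<le> M"
    using coeffs_bounded by blast
  define L where "L = real n * (2 * (1 + real n * M))"
  define C where "C = sqrt (exp (L * (b - a)))"
  have L: "L \<ge> 0" using M(1) by (simp add: L_def)
  show thesis
  proof (rule that[of C])
    show "C \<ge> 0" by (simp add: C_def)
    fix v r s j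
    assume v: "jet_on {a..b} n v" and hom: "\<And>t. t \<in> {a..b} \<Longrightarrow> lin_op v t = 0"
      and r: "r \<in> {a..b}" and s: "s \<in> {a..b}" and j: "j < n"
    define E where "E = (\<lambda>s. \<Sum>j<n. (v j s)\<^sup>2)"
    define E' where "E' = (\<lambda>s. \<Sum>j<n. 2 * v j s * v (Suc j) s)"
    have E_ge: "(v i t)\<^sup>2 \<le> E t" if "i < n" for i t
      unfolding E_def using that by (intro member_le_sum) auto
    have cross: "\<bar>v i t * v m t\<bar> \<le> E t" if "i < n" "m < n" for i m t
    proof -
      have "2 * \<bar>v i t * v m t\<bar> \<le> (v i t)\<^sup>2 + (v m t)\<^sup>2"
        using sum_squares_bound[of "\<bar>v i t\<bar>" "\<bar>v m t\<bar>"] by (simp add: abs_mult)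
      then show ?thesis using E_ge[OF that(1), of t] E_ge[OF that(2), of t] by linarith
    qed
    have E_nonneg: "E t \<ge> 0" for t by (auto simp: E_def intro: sum_nonneg)
    have summand: "\<bar>2 * v i t * v (Suc i) t\<bar> \<le> 2 * (1 + real n * M) * E t"
      if i: "i < n" and t: "t \<in> {a..b}" for i t
    proof (cases "Suc i < n")
      case True
      have "\<bar>2 * v i t * v (Suc i) t\<bar> \<le> 2 * E t"
        using cross[OF i True, of t] by (simp add: abs_mult)
      also have "\<dots> \<le> 2 * (1 + real n * M) * E t"
        using M(1) E_nonneg[of t] by (simp add: algebra_simps)
      finally show ?thesis .
    next
      case False
      then have [simp]: "Suc i = n" using i by simp
      have top: "v n t = - (\<Sum>m<n. c m t * v m t)"
        using hom[OF t] by (simp add: lin_op_def)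
      have "\<bar>v i t * v n t\<bar> = \<bar>\<Sum>m<n. c m t * (v i t * v m t)\<bar>"
        by (simp add: top sum_distrib_left mult_ac)
      also have "\<dots> \<le> (\<Sum>m<n. \<bar>c m t * (v i t * v m t)\<bar>)" by (rule sum_abs)
      also have "\<dots> \<le> (\<Sum>m<n. M * E t)"
        unfolding abs_mult[of "c _ _"] using M t i
        by (intro sum_mono mult_mono cross) auto
      finally have "\<bar>v i t * v n t\<bar> \<le> real n * M * E t" by simp
      then have "\<bar>2 * v i t * v (Suc i) t\<bar> \<le> 2 * (real n * M * E t)"
        by (simp add: abs_mult)
      also have "\<dots> \<le> 2 * (1 + real n * M) * E t"
        using E_nonneg[of t] by (simp add: algebra_simps)
      finally show ?thesis .
    qed
    have "E s \<le> exp (L * \<bar>s - r\<bar>) * E r"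
    proof (rule gronwall_two_sided[OF _ _ r s])
      fix t assume t: "t \<in> {a..b}"
      show "(E has_real_derivative E' t) (at t within {a..b})"
        unfolding E_def E'_def
        using t by (auto intro!: derivative_eq_intros sum.cong jet_onD[OF v])
      have "\<bar>E' t\<bar> \<le> (\<Sum>i<n. \<bar>2 * v i t * v (Suc i) t\<bar>)"
        unfolding E'_def by (rule sum_abs)
      also have "\<dots> \<le> (\<Sum>i<n. 2 * (1 + real n * M) * E t)"
        using t by (intro sum_mono summand) auto
      finally show "\<bar>E' t\<bar> \<le> L * E t" by (simp add: L_def)
    qed
    also have "\<dots> \<le> exp (L * (b - a)) * E r"
      using r s L by (intro mult_right_mono E_nonneg) (auto intro!: mult_left_mono)
    finally have "(v j s)\<^sup>2 \<le> exp (L * (b - a)) * E r"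
      using E_ge[OF j, of s] by linarith
    then have "\<bar>v j s\<bar> \<le> sqrt (exp (L * (b - a)) * E r)"
      using real_le_rsqrt[of "\<bar>v j s\<bar>"] by simp
    also have "\<dots> = C * L2_set (\<lambda>i. v i r) {..<n}"
      by (simp add: C_def real_sqrt_mult L2_set_def E_def)
    also have "\<dots> \<le> C * (\<Sum>i<n. \<bar>v i r\<bar>)"
      by (intro mult_left_mono L2_set_le_sum_abs) (simp add: C_def)
    finally show "\<bar>v j s\<bar> \<le> C * (\<Sum>i<n. \<bar>v i r\<bar>)" .
  qed
qed

lemma lin_op_diff: "lin_op (\<lambda>j s. v j s - w j s) s = lin_op v s - lin_op w s"
  by (simp add: lin_op_def sum_subtractf algebra_simps)

lemma lin_op_uminus: "lin_op (\<lambda>j s. - v j s) s = - lin_op v s"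
  by (simp add: lin_op_def sum_negf)

lemma lin_op_kernel: "r \<in> {a..b} \<Longrightarrow> s \<in> {a..b} \<Longrightarrow> lin_op (\<lambda>j s. k j s r) s = 0"
  using k_hom by (simp add: lin_op_def)

lemma kernel_top: "r \<in> {a..b} \<Longrightarrow> s \<in> {a..b} \<Longrightarrow> k n s r = - (\<Sum>j<n. c j s * k j s r)"
  using k_hom[of r s] by linarith

text \<open>At \<open>s = r\<close> the data of the kernel have absolute sum \<open>1\<close>, whatever \<open>r\<close> is, so stability
  gives a bound uniform in \<open>r\<close>.\<close>

lemma kernel_bounded:
  obtains B where "B \<ge> 0"
    "\<And>j r s. j \<le> n \<Longrightarrow> r \<in> {a..b} \<Longrightarrow> s \<in> {a..b} \<Longrightarrow> \<bar>k j s r\<bar> \<le> B"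
proof -
  obtain M where M: "M \<ge> 0" "\<And>j s. j < n \<Longrightarrow> s \<in> {a..b} \<Longrightarrow> \<bar>c j s\<bar> \<le> M"
    using coeffs_bounded by blast
  obtain C where C: "C \<ge> 0" "\<And>v r s j. jet_on {a..b} n v \<Longrightarrow> (\<And>t. t \<in> {a..b} \<Longrightarrow> lin_op v t = 0) \<Longrightarrow>
       r \<in> {a..b} \<Longrightarrow> s \<in> {a..b} \<Longrightarrow> j < n \<Longrightarrow> \<bar>v j s\<bar> \<le> C * (\<Sum>i<n. \<bar>v i r\<bar>)"
    using homogeneous_stability by blast
  have low: "\<bar>k j s r\<bar> \<le> C" if "j < n" "r \<in> {a..b}" "s \<in> {a..b}" for j r s
  proof -
    have "(\<Sum>i<n. \<bar>k i r r\<bar>) = (\<Sum>i<n. if i = n - 1 then 1 else 0)"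
      using k_diag that by (intro sum.cong) auto
    also have "\<dots> = 1" using n_pos by simp
    finally show ?thesis
      using C(2)[OF k_jet lin_op_kernel, of r r s j] that by simp
  qed
  have high: "\<bar>k n s r\<bar> \<le> real n * (M * C)" if "r \<in> {a..b}" "s \<in> {a..b}" for r s
  proof -
    have "\<bar>k n s r\<bar> \<le> (\<Sum>j<n. \<bar>c j s * k j s r\<bar>)"
      using kernel_top that by simp
    also have "\<dots> \<le> (\<Sum>j<n. M * C)"
      unfolding abs_mult using M that by (intro sum_mono mult_mono low) auto
    finally show ?thesis by simp
  qed
  show thesis
  proof (rule that[of "C + real n * (M * C)"])
    show "0 \<le> C + real n * (M * C)" using C M by simp
    fix j r s assume *: "j \<le> n" "r \<in> {a..b}" "s \<in> {a..b}"
    have "real n * (M * C) \<ge> 0" using C M by simp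
    then show "\<bar>k j s r\<bar> \<le> C + real n * (M * C)"
      using low[of j r s] high[of r s] * C(1) by (cases "j = n") auto
  qed
qed

text \<open>
  Regularity in the parameter \<open>r\<close> comes from stability: \<open>K(\<cdot>; r) - K(\<cdot>; r')\<close> is a homogeneous
  solution, and at \<open>r'\<close> its data are \<open>k i r' r - k i r' r' = k i r' r - k i r r\<close>, the diagonal
  values being the same at all points. This is an increment in the variable \<open>s\<close>, in which the kernel is
  differentiable with bounded derivatives.
\<close>

lemma kernel_continuous_low:
  assumes j: "j < n"
  shows "continuous_on ({a..b} \<times> {a..b}) (\<lambda>(s, r). k j s r)"
proof -
  obtain B where B: "B \<ge> 0"
    "\<And>j r s. j \<le> n \<Longrightarrow> r \<in> {a..b} \<Longrightarrow> s \<in> {a..b} \<Longrightarrow> \<bar>k j s r\<bar> \<le> B"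
    using kernel_bounded by blast
  obtain C where C: "C \<ge> 0" "\<And>v r s j. jet_on {a..b} n v \<Longrightarrow> (\<And>t. t \<in> {a..b} \<Longrightarrow> lin_op v t = 0) \<Longrightarrow>
       r \<in> {a..b} \<Longrightarrow> s \<in> {a..b} \<Longrightarrow> j < n \<Longrightarrow> \<bar>v j s\<bar> \<le> C * (\<Sum>i<n. \<bar>v i r\<bar>)"
    using homogeneous_stability by blast
  have lip_s: "\<bar>k i s r - k i s' r\<bar> \<le> B * \<bar>s - s'\<bar>"
    if "i < n" "r \<in> {a..b}" "s \<in> {a..b}" "s' \<in> {a..b}" for i r s s'
    using field_differentiable_bound[of "{a..b}" "\<lambda>s. k i s r" "\<lambda>s. k (Suc i) s r" B s s']
      that jet_onD[OF k_jet] B(2)[of "Suc i" r] by (auto simp: Suc_le_eq)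
  have lip_r: "\<bar>k j s r - k j s r'\<bar> \<le> C * (real n * B) * \<bar>r - r'\<bar>"
    if "r \<in> {a..b}" "r' \<in> {a..b}" "s \<in> {a..b}" for r r' s
  proof -
    have "\<bar>k j s r - k j s r'\<bar> \<le> C * (\<Sum>i<n. \<bar>k i r' r - k i r' r'\<bar>)"
      using C(2)[OF jet_on_diff[OF k_jet k_jet], of r r' r' s j] that j
      by (auto simp: lin_op_diff lin_op_kernel)
    also have "\<dots> = C * (\<Sum>i<n. \<bar>k i r' r - k i r r\<bar>)"
      using that k_diag by simp
    also have "\<dots> \<le> C * (\<Sum>i<n. B * \<bar>r - r'\<bar>)"
      using that C(1)
      by (intro mult_left_mono sum_mono) (auto simp: abs_minus_commute[of r r'] intro!: lip_s)
    finally show ?thesis by (simp add: mult_ac)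
  qed
  define D where "D = B + C * (real n * B)"
  have "D-lipschitz_on ({a..b} \<times> {a..b}) (\<lambda>(s, r). k j s r)"
  proof (rule lipschitz_onI)
    show "0 \<le> D" using B(1) C(1) by (simp add: D_def)
    fix p q assume pq: "p \<in> {a..b} \<times> {a..b}" "q \<in> {a..b} \<times> {a..b}"
    obtain s r s' r' where [simp]: "p = (s, r)" "q = (s', r')" by (cases p, cases q) auto
    have "\<bar>k j s r - k j s' r'\<bar> \<le> \<bar>k j s r - k j s' r\<bar> + \<bar>k j s' r - k j s' r'\<bar>" by simp
    also have "\<dots> \<le> B * \<bar>s - s'\<bar> + C * (real n * B) * \<bar>r - r'\<bar>"
      using pq j by (intro add_mono lip_s lip_r) auto
    also have "\<dots> \<le> B * dist p q + C * (real n * B) * dist p q"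
      using B(1) C(1) dist_fst_le[of p q] dist_snd_le[of p q]
      by (intro add_mono mult_left_mono) (auto simp: dist_real_def)
    finally show "dist (case p of (s, r) \<Rightarrow> k j s r) (case q of (s, r) \<Rightarrow> k j s r) \<le> D * dist p q"
      by (simp add: D_def dist_real_def algebra_simps)
  qed
  then show ?thesis by (rule lipschitz_on_continuous_on)
qed

lemma kernel_continuous:
  assumes "j \<le> n"
  shows "continuous_on ({a..b} \<times> {a..b}) (\<lambda>p. k j (fst p) (snd p))"
proof (cases "j = n")
  case True
  have "continuous_on ({a..b} \<times> {a..b}) (\<lambda>p. - (\<Sum>j<n. c j (fst p) * k j (fst p) (snd p)))"
    using kernel_continuous_low
    by (auto intro!: continuous_intros continuous_on_compose2[OF c_cont] simp: case_prod_unfold)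
  also have "?this \<longleftrightarrow> ?thesis"
    by (rule continuous_on_cong) (auto simp: True kernel_top)
  finally show ?thesis .
next
  case False
  then show ?thesis using kernel_continuous_low[of j] assms by (simp add: case_prod_unfold)
qed

text \<open>
  Differentiating the integral of \<open>k j s r * h r\<close> over \<open>a \<le> r \<le> s\<close> produces the same integral with
  \<open>j + 1\<close> for \<open>j\<close> and the boundary term \<open>k j s s * h s\<close>. The latter is zero for \<open>j < n - 1\<close> and
  \<open>h s\<close> for \<open>j = n - 1\<close>, so the integral with \<open>j = 0\<close> solves the same initial value problem as
  \<open>u\<close>, and uniqueness applies.
\<close>

lemma duhamel:
  assumes u: "jet_on {a..b} n u" and h: "continuous_on {a..b} h"
    and eq: "\<And>s. s \<in> {a..b} \<Longrightarrow> lin_op u s = h s"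
    and init: "\<And>j. j < n \<Longrightarrow> u j a = 0"
    and s: "s \<in> {a..b}"
  shows "u 0 s = integral {a..s} (\<lambda>r. k 0 s r * h r)"
proof -
  \<comment> \<open>The two occurrences of \<open>s\<close> in \<open>J\<close>, in the integrand and in the upper limit, are separated, so
    that the derivative along the diagonal is the sum of two partial derivatives. The boundary
    term of the last differentiation is put into \<open>J n\<close>, so that \<open>J\<close> is a jet.\<close>
  define W where "W = (\<lambda>j s t. integral {a..t} (\<lambda>r. k j s r * h r))"
  define J where "J = (\<lambda>j s. W j s s + (if j = n then h s else 0))"
  have integrand: "continuous_on ({a..b} \<times> {a..b}) (\<lambda>p. k j (fst p) (snd p) * h (snd p))"
    if "j \<le> n" for j
    by (intro continuous_intros kernel_continuous that continuous_on_compose2[OF h]) auto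
  have slice: "continuous_on {a..b} (\<lambda>r. k j x r * h r)" if "j \<le> n" "x \<in> {a..b}" for j x
    by (rule continuous_on_compose2[OF integrand[OF that(1)], where f = "\<lambda>r. (x, r)", simplified])
       (use that in \<open>auto intro!: continuous_intros\<close>)
  have W_s: "((\<lambda>s. W j s t) has_real_derivative W (Suc j) s t) (at s within {a..b})"
    if "j < n" "s \<in> {a..b}" "t \<in> {a..b}" for j s t
    unfolding W_def box_real(2)[symmetric]
  proof (rule leibniz_rule_field_derivative)
    show "((\<lambda>s. k j s r * h r) has_real_derivative k (Suc j) x r * h r) (at x within cbox a b)"
      if "x \<in> cbox a b" "r \<in> cbox a t" for x r
      using that \<open>j < n\<close> \<open>t \<in> {a..b}\<close>
      by (auto intro!: derivative_eq_intros jet_onD[OF k_jet, of r])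
    show "(\<lambda>r. k j x r * h r) integrable_on cbox a t" if "x \<in> cbox a b" for x
      using that \<open>j < n\<close> \<open>t \<in> {a..b}\<close>
      by (intro integrable_continuous continuous_on_subset[OF slice]) auto
    show "continuous_on (cbox a b \<times> cbox a t) (\<lambda>(x, r). k (Suc j) x r * h r)"
      unfolding case_prod_unfold using \<open>j < n\<close> \<open>t \<in> {a..b}\<close>
      by (intro continuous_on_subset[OF integrand]) auto
  qed (use that in auto)
  have W_t: "((\<lambda>t. W j s t) has_real_derivative k j s t * h t) (at t within {a..b})"
    if "j < n" "s \<in> {a..b}" "t \<in> {a..b}" for j s t
    unfolding W_def using that by (intro integral_has_real_derivative slice) auto
  have W_diag: "((\<lambda>s. W j s s) has_real_derivative W (Suc j) s s + k j s s * h s) (at s within {a..b})"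
    if "j < n" "s \<in> {a..b}" for j s
  proof -
    have "((\<lambda>(x, y). W j x y) has_derivative
        (\<lambda>(tx, ty). W (Suc j) s s * tx + blinfun_mult_right (k j s s * h s) ty))
        (at (s, s) within {a..b} \<times> {a..b})"
    proof (rule has_derivative_partialsI[where f = "W j"
            and fy = "\<lambda>x y. blinfun_mult_right (k j x y * h y)"])
      show "((\<lambda>x. W j x s) has_derivative (*) (W (Suc j) s s)) (at s within {a..b})"
        using W_s[OF that that(2)] by (simp add: has_field_derivative_def)
      show "(W j x has_derivative blinfun_mult_right (k j x y * h y)) (at y within {a..b})"
        if "x \<in> {a..b}" "y \<in> {a..b}" for x y
        using W_t[OF \<open>j < n\<close> that] by (simp add: has_field_derivative_def)
      have "continuous (at (s, s) within {a..b} \<times> {a..b}) (\<lambda>p. k j (fst p) (snd p) * h (snd p))"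
        using integrand[of j] that by (auto simp: continuous_on_eq_continuous_within)
      then show "continuous (at (s, s) within {a..b} \<times> {a..b})
          (\<lambda>(x, y). blinfun_mult_right (k j x y * h y))"
        unfolding case_prod_unfold
        by (rule bounded_linear.continuous[OF bounded_linear_blinfun_mult_right])
    qed (use that in auto)
    then have "((\<lambda>(x, y). W j x y) has_derivative
        (\<lambda>(tx, ty). W (Suc j) s s * tx + blinfun_mult_right (k j s s * h s) ty))
        (at (s, s) within (\<lambda>s. (s, s)) ` {a..b})"
      by (rule has_derivative_subset) auto
    moreover have "((\<lambda>t. (t, t)) has_derivative (\<lambda>t. (t, t))) (at s within {a..b})"
      by (intro has_derivative_Pair has_derivative_ident)
    ultimately have "((\<lambda>s. W j s s) has_derivative
        (\<lambda>t. W (Suc j) s s * t + k j s s * h s * t)) (at s within {a..b})"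
      using has_derivative_in_compose by fastforce
    moreover have "(\<lambda>t. W (Suc j) s s * t + k j s s * h s * t) = (*) (W (Suc j) s s + k j s s * h s)"
      by (simp add: fun_eq_iff distrib_right)
    ultimately show ?thesis
      by (simp add: has_field_derivative_def)
  qed
  have J_jet: "jet_on {a..b} n J"
    unfolding jet_on_def
  proof (intro allI impI ballI)
    fix j s assume js: "j < n" "s \<in> {a..b}"
    have "J (Suc j) s = W (Suc j) s s + k j s s * h s"
      using js k_diag[of s j] n_pos by (auto simp: J_def)
    moreover have "J j = (\<lambda>s. W j s s)" using js by (auto simp: J_def)
    ultimately show "(J j has_real_derivative J (Suc j) s) (at s within {a..b})"
      using W_diag[OF js] by simp
  qed
  have J_op: "lin_op J t = h t" if t: "t \<in> {a..b}" for t
  proof -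
    have int: "(\<lambda>r. k j t r * h r) integrable_on {a..t}" if "j \<le> n" for j
      using that t by (intro integrable_continuous_real continuous_on_subset[OF slice]) auto
    have "((\<lambda>r. k n t r * h r + (\<Sum>j<n. c j t * (k j t r * h r))) has_integral
        W n t t + (\<Sum>j<n. c j t * W j t t)) {a..t}"
      unfolding W_def
      by (intro has_integral_add has_integral_sum has_integral_mult_right integrable_integral int) auto
    then have "W n t t + (\<Sum>j<n. c j t * W j t t) =
       integral {a..t} (\<lambda>r. k n t r * h r + (\<Sum>j<n. c j t * (k j t r * h r)))"
      by (rule integral_unique[symmetric])
    also have "\<dots> = integral {a..t} (\<lambda>r. 0)"
    proof (rule integral_cong)
      fix r assume "r \<in> {a..t}"
      then have "(k n t r + (\<Sum>j<n. c j t * k j t r)) * h r = 0"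
        using k_hom[of r t] t by simp
      then show "k n t r * h r + (\<Sum>j<n. c j t * (k j t r * h r)) = 0"
        by (simp add: algebra_simps sum_distrib_left)
    qed
    finally show ?thesis by (simp add: lin_op_def J_def)
  qed
  obtain C where "C \<ge> 0" and C: "\<And>v r s j. jet_on {a..b} n v \<Longrightarrow> (\<And>t. t \<in> {a..b} \<Longrightarrow> lin_op v t = 0) \<Longrightarrow>
       r \<in> {a..b} \<Longrightarrow> s \<in> {a..b} \<Longrightarrow> j < n \<Longrightarrow> \<bar>v j s\<bar> \<le> C * (\<Sum>i<n. \<bar>v i r\<bar>)"
    using homogeneous_stability by blast
  have "\<bar>u 0 s - J 0 s\<bar> \<le> C * (\<Sum>i<n. \<bar>u i a - J i a\<bar>)"
    using ab s n_pos by (intro C jet_on_diff u J_jet) (auto simp: lin_op_diff eq J_op)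
  also have "(\<Sum>i<n. \<bar>u i a - J i a\<bar>) = 0"
    by (simp add: init J_def W_def)
  finally show ?thesis using n_pos by (simp add: J_def W_def)
qed

section \<open>The kernel does not vanish on an interval\<close>

lemma kernel_continuous_left:
  assumes "j \<le> n" "r \<in> {a..b}"
  shows "continuous_on {a..b} (\<lambda>s. k j s r)"
  by (rule continuous_on_compose2[OF kernel_continuous[OF assms(1)],
        where f = "\<lambda>s. (s, r)", simplified])
     (use assms(2) in \<open>auto intro!: continuous_intros\<close>)

lemma kernel_continuous_right:
  assumes "j \<le> n" "s \<in> {a..b}"
  shows "continuous_on {a..b} (\<lambda>r. k j s r)"
  by (rule continuous_on_compose2[OF kernel_continuous[OF assms(1)],
        where f = "\<lambda>r. (s, r)", simplified])
     (use assms(2) in \<open>auto intro!: continuous_intros\<close>)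

lemma lin_op_continuous:
  assumes "\<And>j. j \<le> n \<Longrightarrow> continuous_on {a..b} (u j)"
  shows "continuous_on {a..b} (lin_op u)"
  unfolding lin_op_def using assms by (auto intro!: continuous_intros c_cont)

text \<open>Otherwise Duhamel's formula would force every \<open>C\<^sup>n\<close> function with zero data at \<open>a\<close> to
  vanish at \<open>b\<close>; the function \<open>(s - a)\<^sup>n\<close> does not.\<close>

lemma kernel_nonzero_somewhere: "\<exists>r\<in>{a..b}. k 0 b r \<noteq> 0"
proof (rule ccontr)
  assume neg: "\<not> (\<exists>r\<in>{a..b}. k 0 b r \<noteq> 0)"
  define u where "u = (\<lambda>j s. fact n / fact (n - j) * (s - a) ^ (n - j) :: real)"
  have jet: "jet_on {a..b} n u"
    unfolding jet_on_def
  proof (intro allI impI ballI)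
    fix j s assume "j < n"
    then obtain m where m: "n - j = Suc m" "n - Suc j = m"
      by (metis Suc_diff_Suc)
    have "((\<lambda>s. s - a) has_real_derivative 1) (at s within {a..b})"
      by (auto intro!: derivative_eq_intros)
    from DERIV_cmult[OF DERIV_power_Suc[OF this, of m], of "fact n / fact (Suc m)"]
    show "(u j has_real_derivative u (Suc j) s) (at s within {a..b})"
      unfolding u_def m by (simp add: divide_simps mult_ac)
  qed
  have "continuous_on {a..b} (lin_op u)"
    by (rule lin_op_continuous) (auto simp: u_def intro!: continuous_intros)
  from duhamel[OF jet this, of b] have "u 0 b = integral {a..b} (\<lambda>r. k 0 b r * lin_op u r)"
    using ab by (simp add: u_def)
  also have "\<dots> = integral {a..b} (\<lambda>r. 0)"
    using neg by (intro integral_cong) auto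
  finally show False using ab by (simp add: u_def)
qed

text \<open>
  With \<open>v = K(\<cdot>; r\<^sub>0)\<close> nonzero at \<open>b\<close> and \<open>\<theta>\<close> a smooth step on \<open>[c', d]\<close>, the product \<open>u = \<theta> v\<close> has zero
  data at \<open>a\<close>, agrees with \<open>v\<close> beyond \<open>d\<close>, and satisfies the homogeneous equation
  outside \<open>[c', d]\<close>. If \<open>K(b; \<cdot>)\<close> vanished on \<open>[c', d]\<close>, the Duhamel integral for \<open>u b = v b\<close> would be zero.
\<close>

lemma kernel_not_vanishing_on_interval:
  assumes cd: "a \<le> c'" "c' < d" "d \<le> b"
  shows "\<exists>r\<in>{c'..d}. k 0 b r \<noteq> 0"
proof (rule ccontr)
  assume neg: "\<not> (\<exists>r\<in>{c'..d}. k 0 b r \<noteq> 0)"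
  obtain r\<^sub>0 where r\<^sub>0: "r\<^sub>0 \<in> {a..b}" "k 0 b r\<^sub>0 \<noteq> 0"
    using kernel_nonzero_somewhere by blast
  define v where "v = (\<lambda>j s. k j s r\<^sub>0)"
  obtain \<theta> where \<theta>': "jet_on UNIV n \<theta>" "continuous_on UNIV (\<theta> n)"
     "\<forall>s\<le>c'. \<theta> 0 s = 0" "\<forall>s\<ge>d. \<theta> 0 s = 1"
     "\<forall>j s. 0 < j \<longrightarrow> j \<le> n \<longrightarrow> s \<le> c' \<or> d \<le> s \<longrightarrow> \<theta> j s = 0"
    using smooth_step_jet[OF cd(2), of n] by blast
  note \<theta> = \<theta>'[rule_format]
  define u where "u = (\<lambda>j s. \<Sum>i\<le>j. real (j choose i) * \<theta> i s * v (j - i) s)"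
  have jet: "jet_on {a..b} n u"
    unfolding u_def v_def using r\<^sub>0(1)
    by (intro jet_on_mult k_jet jet_on_subset[OF \<theta>(1)]) auto
  have \<theta>_cont: "continuous_on {a..b} (\<theta> i)" if "i \<le> n" for i
    using that \<theta>(2) jet_on_continuous[OF \<theta>(1), of i] continuous_on_subset[OF _ subset_UNIV]
    by (cases "i = n") auto
  have cont: "continuous_on {a..b} (lin_op u)"
    unfolding u_def v_def using r\<^sub>0(1)
    by (intro lin_op_continuous continuous_intros \<theta>_cont kernel_continuous_left) auto
  have outside: "u j s = \<theta> 0 s * v j s" if "j \<le> n" "s \<le> c' \<or> d \<le> s" for j s
  proof -
    have "u j s = (\<Sum>i\<le>j. if i = 0 then \<theta> 0 s * v j s else 0)"
      unfolding u_def using that \<theta>(5) by (intro sum.cong) auto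
    then show ?thesis by simp
  qed
  have source: "k 0 b r * lin_op u r = 0" if r: "r \<in> {a..b}" for r
  proof (cases "r \<in> {c'..d}")
    case False
    then have "lin_op u r = \<theta> 0 r * lin_op v r"
      by (auto simp: lin_op_def outside algebra_simps sum_distrib_left)
    then show ?thesis using lin_op_kernel[OF r\<^sub>0(1) r] by (simp add: v_def)
  qed (use neg in auto)
  have "u 0 b = integral {a..b} (\<lambda>r. k 0 b r * lin_op u r)"
    using duhamel[OF jet cont, of b] ab outside[of _ a] \<theta>(3)[of a] cd by auto
  also have "\<dots> = integral {a..b} (\<lambda>r. 0)"
    using source by (intro integral_cong) auto
  finally show False
    using outside[of 0 b] \<theta>(4)[of b] cd r\<^sub>0(2) by (simp add: v_def)
qed

section \<open>Comparison\<close>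

lemma forward_positive_comparison:
  assumes pos: "\<forall>r\<in>{a..b}. \<forall>s\<in>{a..b}. r < s \<longrightarrow> 0 \<le> k 0 s r"
    and u: "jet_on {a..b} n u" and h: "continuous_on {a..b} h"
    and eq: "\<forall>s\<in>{a..b}. lin_op u s = h s"
    and init: "\<forall>j<n. u j a = 0"
    and h_nonneg: "\<forall>s\<in>{a..b}. 0 \<le> h s"
  shows "\<forall>s\<in>{a..b}. 0 \<le> u 0 s"
    and "u 0 b = 0 \<Longrightarrow> \<forall>s\<in>{a..b}. h s = 0 \<and> u 0 s = 0"
proof -
  have repr: "u 0 s = integral {a..s} (\<lambda>r. k 0 s r * h r)" if "s \<in> {a..b}" for s
    using that by (intro duhamel[OF u h]) (auto simp: eq init)
  \<comment> \<open>On the diagonal the kernel is \<open>1\<close> if \<open>n = 1\<close> and \<open>0\<close> otherwise.\<close>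
  have pos': "0 \<le> k 0 s r" if "s \<in> {a..b}" "r \<in> {a..s}" for s r
    using pos k_diag[of s 0] n_pos that by (cases "r = s") auto
  have cont: "continuous_on {a..b} (\<lambda>r. k 0 s r * h r)" if "s \<in> {a..b}" for s
    using that by (intro continuous_intros h kernel_continuous_right) auto
  show "\<forall>s\<in>{a..b}. 0 \<le> u 0 s"
  proof
    fix s assume s: "s \<in> {a..b}"
    show "0 \<le> u 0 s"
      unfolding repr[OF s]
    proof (rule integral_nonneg)
      show "(\<lambda>r. k 0 s r * h r) integrable_on {a..s}"
        using s by (intro integrable_continuous_real continuous_on_subset[OF cont]) auto
    qed (use s pos' h_nonneg in auto)
  qed
  assume ub: "u 0 b = 0"
  have b: "b \<in> {a..b}" using ab by simp
  have prod0: "\<forall>r\<in>{a..b}. k 0 b r * h r = 0"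
    using integral_eq_0_iff[OF cont[OF b] ab] repr[OF b] ub pos'[OF b] h_nonneg by simp
  have h0: "h r = 0" if r: "r \<in> {a..b}" for r
  proof (rule ccontr)
    assume "h r \<noteq> 0"
    then have "\<forall>\<^sub>F x in at r within {a..b}. h x \<noteq> 0"
      using h r tendsto_imp_eventually_ne unfolding continuous_on_def by blast
    then obtain e where e: "e > 0" "\<And>x. x \<in> {a..b} \<Longrightarrow> dist x r < e \<Longrightarrow> h x \<noteq> 0"
      unfolding eventually_at using \<open>h r \<noteq> 0\<close> by metis
    define c' where "c' = max a (r - e / 2)"
    define d where "d = min b (r + e / 2)"
    have cd: "a \<le> c'" "c' < d" "d \<le> b"
      using e(1) r ab by (auto simp: c'_def d_def)
    have "k 0 b x = 0" if "x \<in> {c'..d}" for x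
    proof -
      have "x \<in> {a..b}" "dist x r < e"
        using that e(1) by (auto simp: c'_def d_def dist_real_def)
      then show ?thesis using e(2) prod0 by auto
    qed
    then show False using kernel_not_vanishing_on_interval[OF cd] by blast
  qed
  have "u 0 s = 0" if s: "s \<in> {a..b}" for s
  proof -
    have "u 0 s = integral {a..s} (\<lambda>r. 0)"
      unfolding repr[OF s] using s h0 by (intro integral_cong) auto
    then show ?thesis by simp
  qed
  then show "\<forall>s\<in>{a..b}. h s = 0 \<and> u 0 s = 0" using h0 by blast
qed

end

text \<open>The complement of a null set is dense, because nonempty open sets are not null.\<close>

lemma AE_imp_all_closed:
  fixes g :: "real \<Rightarrow> 'a::topological_space"
  assumes "a < b" and ae: "AE s in lebesgue. s \<in> {a..b} \<longrightarrow> P s"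
    and g: "continuous_on {a..b} g" and T: "closed T"
    and PT: "\<And>s. s \<in> {a..b} \<Longrightarrow> P s \<Longrightarrow> g s \<in> T"
  shows "\<forall>s\<in>{a..b}. g s \<in> T"
proof -
  define N where "N = {s. \<not> (s \<in> {a..b} \<longrightarrow> P s)}"
  obtain N' where N': "N \<subseteq> N'" "N' \<in> null_sets lebesgue"
    using ae unfolding N_def eventually_ae_filter by auto
  then have "negligible (interior N')"
    using negligible_subset[OF _ interior_subset] by (simp add: negligible_iff_null_sets)
  then have "closure (- N') = UNIV"
    using open_not_negligible[OF open_interior] by (auto simp: closure_complement)
  then have "{a<..<b} \<subseteq> closure ({a<..<b} \<inter> - N')"
    using open_Int_closure_subset[of "{a<..<b}" "- N'"] by simp
  moreover have closed: "closed ({a..b} \<inter> g -` T)"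
    using continuous_on_closed_vimage[of "{a..b}" g] g T by (simp add: Int_commute)
  moreover have "P x" if "x \<in> {a..b}" "x \<notin> N'" for x
    using that N'(1) by (auto simp: N_def)
  then have "{a<..<b} \<inter> - N' \<subseteq> {a..b} \<inter> g -` T"
    using PT by auto
  ultimately have "{a<..<b} \<subseteq> {a..b} \<inter> g -` T"
    by (meson closure_minimal order_trans)
  then have "closure {a<..<b} \<subseteq> {a..b} \<inter> g -` T"
    using closed by (rule closure_minimal)
  then show ?thesis using \<open>a < b\<close> by auto
qed

lemma lagrange_jets_of_kernel:
  assumes "a < b" "0 < n" and c: "\<And>j. j < n \<Longrightarrow> continuous_on {a..b} (c j)"
    and K: "is_Lagrange_kernel {a..b} n c K"
  shows "lagrange_jets a b n c (\<lambda>j s r. nderiv_on {a..b} j (\<lambda>s. K s r) s)"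
proof
  fix r assume r: "r \<in> {a..b}"
  show "jet_on {a..b} n (\<lambda>j s. nderiv_on {a..b} j (\<lambda>s. K s r) s)"
    using K r Cn_on_imp_jet_on[OF assms(1)] by (simp add: is_Lagrange_kernel_def)
  fix j assume "j < n"
  then show "nderiv_on {a..b} j (\<lambda>s. K s r) r = (if j = n - 1 then 1 else 0)"
    using K r by (auto simp: is_Lagrange_kernel_def)
qed (use assms in \<open>auto simp: is_Lagrange_kernel_def lin_diff_op_def\<close>)

theorem theorem3p7:
  fixes a b :: real
    and n l :: nat
    and \<kappa> \<kappa>' f y y' :: "real \<Rightarrow> real"
    and K' :: "real \<Rightarrow> real \<Rightarrow> real"
  assumes "a < b"
    and "l < n"
    and "continuous_on {a..b} \<kappa>"
    and "continuous_on {a..b} \<kappa>'"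
    and "continuous_on {a..b} f"
    and "Cn_on n y {a..b}"
    and "Cn_on n y' {a..b}"
    and "\<forall>s\<in>{a..b}. nderiv_on {a..b} n y s + \<kappa> s * nderiv_on {a..b} l y s = f s"
    and "\<forall>s\<in>{a..b}. nderiv_on {a..b} n y' s + \<kappa>' s * nderiv_on {a..b} l y' s = f s"
    and "\<forall>j<n. nderiv_on {a..b} j y a = nderiv_on {a..b} j y' a"
    and "is_Lagrange_kernel {a..b} n (\<lambda>j s. if j = l then \<kappa>' s else 0) K'"
    and "forward_positive {a..b} K'"
    and "AE s in lebesgue. s \<in> {a..b} \<longrightarrow> nderiv_on {a..b} l y s > 0"
  shows "((\<forall>s\<in>{a..b}. \<kappa> s \<le> \<kappa>' s) \<longrightarrow> (\<forall>s\<in>{a..b}. y s \<ge> y' s)) \<and>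
         ((\<forall>s\<in>{a..b}. \<kappa> s \<ge> \<kappa>' s) \<longrightarrow> (\<forall>s\<in>{a..b}. y s \<le> y' s)) \<and>
         ((\<forall>s\<in>{a..b}. \<kappa> s \<le> \<kappa>' s) \<or> (\<forall>s\<in>{a..b}. \<kappa> s \<ge> \<kappa>' s) \<longrightarrow>
            y b = y' b \<longrightarrow> (\<forall>s\<in>{a..b}. \<kappa> s = \<kappa>' s \<and> y s = y' s))"
proof -
  let ?D = "nderiv_on {a..b}"
  have coeff_cont: "continuous_on {a..b} (\<lambda>s. if j = l then \<kappa>' s else 0)" for j
    using assms(4) by (cases "j = l") auto
  interpret lagrange_jets a b n "\<lambda>j s. if j = l then \<kappa>' s else 0"
    "\<lambda>j s r. ?D j (\<lambda>s. K' s r) s"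
    using assms(1,2,11) coeff_cont by (intro lagrange_jets_of_kernel) auto
  have op_eq: "lin_op u s = u n s + \<kappa>' s * u l s" for u s
    using \<open>l < n\<close> by (simp add: lin_op_def if_distrib[of "\<lambda>x. x * _"] cong: if_cong)
  have pos: "\<forall>r\<in>{a..b}. \<forall>s\<in>{a..b}. r < s \<longrightarrow> 0 \<le> ?D 0 (\<lambda>s. K' s r) s"
    using assms(12) by (simp add: forward_positive_def)
  have jets: "jet_on {a..b} n (\<lambda>j. ?D j y)" "jet_on {a..b} n (\<lambda>j. ?D j y')"
    using assms(1,6,7) Cn_on_imp_jet_on by auto
  have yl_cont: "continuous_on {a..b} (?D l y)"
    using jet_on_continuous[OF jets(1) \<open>l < n\<close>] .
  have yl_nonneg: "\<forall>s\<in>{a..b}. ?D l y s \<in> {0..}"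
    by (rule AE_imp_all_closed[OF \<open>a < b\<close> assms(13) yl_cont]) auto
  define u where "u = (\<lambda>j s. ?D j y s - ?D j y' s)"
  define h where "h = (\<lambda>s. (\<kappa>' s - \<kappa> s) * ?D l y s)"
  have u: "jet_on {a..b} n u" "\<forall>j<n. u j a = 0"
    using jet_on_diff[OF jets] assms(10) by (auto simp: u_def)
  have h_cont: "continuous_on {a..b} h"
    unfolding h_def using assms(3,4) yl_cont by (intro continuous_intros)
  have u_op: "\<forall>s\<in>{a..b}. lin_op u s = h s"
    using assms(8,9) unfolding op_eq by (auto simp: u_def h_def algebra_simps)
  have minus: "jet_on {a..b} n (\<lambda>j s. - u j s)" "continuous_on {a..b} (\<lambda>s. - h s)"
    "\<forall>s\<in>{a..b}. lin_op (\<lambda>j s. - u j s) s = - h s" "\<forall>j<n. - u j a = 0"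
    using jet_on_uminus[OF u(1)] u(2) h_cont u_op
    by (auto simp: lin_op_uminus intro!: continuous_intros)
  \<comment> \<open>Where \<open>y\<^sup>(\<^sup>l\<^sup>)\<close> is positive, \<open>h = 0\<close> forces \<open>\<kappa> = \<kappa>'\<close>; the remaining points are reached by
    continuity.\<close>
  have \<kappa>_eq: "\<forall>s\<in>{a..b}. \<kappa> s = \<kappa>' s" if "\<forall>s\<in>{a..b}. h s = 0"
  proof -
    have "\<forall>s\<in>{a..b}. \<kappa>' s - \<kappa> s \<in> {0}"
      using assms(3,4) that
      by (intro AE_imp_all_closed[OF \<open>a < b\<close> assms(13)]) (auto simp: h_def intro!: continuous_intros)
    then show ?thesis by auto
  qed
  have h_nonneg: "\<forall>s\<in>{a..b}. 0 \<le> h s" if "\<forall>s\<in>{a..b}. \<kappa> s \<le> \<kappa>' s"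
    using that yl_nonneg by (auto simp: h_def)
  have h_nonpos: "\<forall>s\<in>{a..b}. 0 \<le> - h s" if "\<forall>s\<in>{a..b}. \<kappa> s \<ge> \<kappa>' s"
    using that yl_nonneg by (auto simp: h_def mult_nonpos_nonneg)
  note upper = forward_positive_comparison[OF pos u(1) h_cont u_op u(2) h_nonneg]
  note lower = forward_positive_comparison[OF pos minus h_nonpos]
  show ?thesis
  proof (intro conjI impI)
    assume "\<forall>s\<in>{a..b}. \<kappa> s \<le> \<kappa>' s"
    then show "\<forall>s\<in>{a..b}. y s \<ge> y' s" using upper(1) by (simp add: u_def)
  next
    assume "\<forall>s\<in>{a..b}. \<kappa> s \<ge> \<kappa>' s"
    then show "\<forall>s\<in>{a..b}. y s \<le> y' s" using lower(1) by (simp add: u_def)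
  next
    assume ord: "(\<forall>s\<in>{a..b}. \<kappa> s \<le> \<kappa>' s) \<or> (\<forall>s\<in>{a..b}. \<kappa> s \<ge> \<kappa>' s)" and "y b = y' b"
    then have ub: "u 0 b = 0" by (simp add: u_def)
    from ord have "\<forall>s\<in>{a..b}. h s = 0 \<and> u 0 s = 0"
    proof
      assume "\<forall>s\<in>{a..b}. \<kappa> s \<le> \<kappa>' s"
      then show ?thesis using upper(2) ub by blast
    next
      assume "\<forall>s\<in>{a..b}. \<kappa> s \<ge> \<kappa>' s"
      then show ?thesis using lower(2) ub by simp
    qed
    then show "\<forall>s\<in>{a..b}. \<kappa> s = \<kappa>' s \<and> y s = y' s"
      using \<kappa>_eq by (simp add: u_def)
  qed
qed

end
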